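(* Let $P \subset \mathbb{R}^d$ be a random $0/1$ polytope distributed according to any one of the following three models: (i) (balls-into-bins model) for some $n \in \mathbb{N}$, choose $S_1,\dots,S_n$ independently and uniformly at random from $\{0,1\}^d$ (repetition allowed) and let $P = \operatorname{conv}\{S_1,\dots,S_n\}$; (ii) (binomial model) for some $p \in (0,1)$, let $S \subset \{0,1\}^d$ be the random set containing each $v \in \{0,1\}^d$ independently with probability $p$, and let $P = \operatorname{conv} S$; (iii) (uniform model) for some $1 \le n \le 2^d$, let $U$ be chosen uniformly at random among all $n$-element subsets of $\{0,1\}^d$, and let $P = \operatorname{conv} U$. Then the edge expansion of $P$ is at least $\frac{1}{12d}$ with high probability, i.e. with probability at least $f(d)$, where $f$ is a function of $d$ alone (independent of the model parameter $n$ or $p$) with $f(d) \to 1$ as $d \to \infty$.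
   Context: A $0/1$ polytope in $\mathbb{R}^d$ is the convex hull of a subset of $\{0,1\}^d$. The graph $G(P)$ of a polytope $P$ has as vertices the vertices of $P$ and as edges the edges ($1$-dimensional faces) of $P$. For a graph $G=(V,E)$ and $S \subset V$, $\delta(S)$ denotes the set of edges joining a vertex of $S$ to a vertex of $V \setminus S$. The edge expansion of $G$ is $\min\{ |\delta(S)|/|S| : S \subset V,\ 1 \le |S| \le |V|/2\}$, and the edge expansion of a polytope is the edge expansion of its graph. *)

theory Defs
  imports "HOL-Analysis.Analysis" "HOL-Probability.Probability" "HOL-Library.Function_Algebras"
begin

text \<open>
  The dimension \<open>d\<close> is a bound variable of the theorem, so all spaces \<open>\<real>\<^sup>d\<close> are realised inside the
  single real vector space \<open>nat \<Rightarrow> real\<close>, as the subspace of functions vanishing outside \<open>{..<d}\<close>.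
  Convex hulls, faces, extreme points and affine dimension do not depend on the ambient space.
\<close>

instantiation "fun" :: (type, scaleR) scaleR
begin

definition scaleR_fun :: "real \<Rightarrow> ('a \<Rightarrow> 'b) \<Rightarrow> 'a \<Rightarrow> 'b"
  where "scaleR_fun r x = (\<lambda>i. r *\<^sub>R x i)"

instance ..

end

instance "fun" :: (type, real_vector) real_vector
  by standard (simp_all add: scaleR_fun_def plus_fun_def fun_eq_iff algebra_simps)

definition cube01 :: "nat \<Rightarrow> (nat \<Rightarrow> real) set"
  where "cube01 d = {x. (\<forall>i<d. x i \<in> {0, 1}) \<and> (\<forall>i\<ge>d. x i = 0)}"

text \<open>
  The library's \<open>aff_dim\<close> and \<open>edge_of\<close> are restricted to Euclidean spaces; the following predicate is
  the defining property of \<open>aff_dim S = int k\<close>, stated for arbitrary real vector spaces.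
\<close>

definition has_aff_dim :: "'a::real_vector set \<Rightarrow> nat \<Rightarrow> bool"
  where "has_aff_dim S k \<longleftrightarrow>
    (\<exists>B. affine hull B = affine hull S \<and> \<not> affine_dependent B \<and> card B = k + 1)"

definition polytope_vertices :: "'a::real_vector set \<Rightarrow> 'a set"
  where "polytope_vertices P = {v. v extreme_point_of P}"

text \<open>A one-dimensional face enters the graph as the set of its two endpoints.\<close>

definition polytope_edges :: "'a::real_vector set \<Rightarrow> 'a set set"
  where "polytope_edges P = {F \<inter> polytope_vertices P |F. F face_of P \<and> has_aff_dim F 1}"

definition edge_boundary :: "'v set \<Rightarrow> 'v set set \<Rightarrow> 'v set \<Rightarrow> 'v set set"
  where "edge_boundary V E S = {e \<in> E. \<exists>u\<in>S. \<exists>v\<in>V - S. e = {u, v}}"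

text \<open>
  The minimum is taken in the extended reals, so that it is \<open>\<infinity>\<close> for a graph with at most one vertex,
  where no admissible \<open>S\<close> exists.
\<close>

definition edge_expansion :: "'v set \<Rightarrow> 'v set set \<Rightarrow> ereal"
  where "edge_expansion V E =
    (INF S \<in> {S. S \<subseteq> V \<and> 1 \<le> card S \<and> real (card S) \<le> real (card V) / 2}.
       ereal (real (card (edge_boundary V E S)) / real (card S)))"

definition polytope_edge_expansion :: "'a::real_vector set \<Rightarrow> ereal"
  where "polytope_edge_expansion P = edge_expansion (polytope_vertices P) (polytope_edges P)"

definition balls_into_bins_polytope :: "nat \<Rightarrow> nat \<Rightarrow> (nat \<Rightarrow> real) set pmf"
  where "balls_into_bins_polytope d n =
    map_pmf (\<lambda>s. convex hull (s ` {1..n})) (Pi_pmf {1..n} 0 (\<lambda>_. pmf_of_set (cube01 d)))"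

definition binomial_polytope :: "nat \<Rightarrow> real \<Rightarrow> (nat \<Rightarrow> real) set pmf"
  where "binomial_polytope d p =
    map_pmf (\<lambda>b. convex hull {v \<in> cube01 d. b v}) (Pi_pmf (cube01 d) False (\<lambda>_. bernoulli_pmf p))"

definition uniform_polytope :: "nat \<Rightarrow> nat \<Rightarrow> (nat \<Rightarrow> real) set pmf"
  where "uniform_polytope d n =
    map_pmf (\<lambda>U. convex hull U) (pmf_of_set {U. U \<subseteq> cube01 d \<and> card U = n})"

text \<open>
  \<open>pmf_of_set\<close> and \<open>Pi_pmf\<close> are only meaningful for finite (nonempty) index sets.
\<close>

lemma cube01_eq_image: "cube01 d = (\<lambda>A i. if i \<in> A then 1 else 0) ` Pow {..<d}"
proof (intro equalityI subsetI)
  fix x assume x: "x \<in> cube01 d"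
  have "x = (\<lambda>i. if i \<in> {i. i < d \<and> x i = 1} then 1 else 0)"
  proof
    fix i show "x i = (if i \<in> {i. i < d \<and> x i = 1} then 1 else 0)"
      using x by (cases "i < d") (auto simp: cube01_def)
  qed
  then show "x \<in> (\<lambda>A i. if i \<in> A then 1 else 0) ` Pow {..<d}"
    by (rule image_eqI) auto
next
  fix x :: "nat \<Rightarrow> real"
  assume "x \<in> (\<lambda>A i. if i \<in> A then 1 else 0) ` Pow {..<d}"
  then show "x \<in> cube01 d" by (auto simp: cube01_def)
qed

lemma finite_cube01: "finite (cube01 d)"
  by (simp add: cube01_eq_image)

lemma card_cube01: "card (cube01 d) = 2 ^ d"
proof -
  have "inj_on (\<lambda>A i. if i \<in> A then (1::real) else 0) (Pow {..<d})"
    by (intro inj_onI) (auto simp: fun_eq_iff split: if_splits)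
  then show ?thesis
    by (simp add: cube01_eq_image card_image card_Pow)
qed

lemma cube01_nonempty: "cube01 d \<noteq> {}"
  by (auto simp: cube01_eq_image)

lemma uniform_support:
  assumes "n \<le> 2 ^ d"
  shows "finite {U. U \<subseteq> cube01 d \<and> card U = n}" and "{U. U \<subseteq> cube01 d \<and> card U = n} \<noteq> {}"
proof -
  show "finite {U. U \<subseteq> cube01 d \<and> card U = n}"
    by (rule finite_subset[of _ "Pow (cube01 d)"]) (auto simp: finite_cube01)
  show "{U. U \<subseteq> cube01 d \<and> card U = n} \<noteq> {}"
    using obtain_subset_with_card_n[of n "cube01 d"] assms by (auto simp: card_cube01)
qed

end

theory Submission
  imports Defs
begin

text \<open>
  Cut the cube into the \<open>2 ^ k\<close> faces (blocks) obtained by fixing the first \<open>k\<close> coordinates.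
  Suppose every block contains at least one and at most \<open>m\<close> points of \<open>S\<close>. Then \<open>conv S\<close> has edge
  expansion at least \<open>1 / m\<close>: let \<open>A\<close> be a set of vertices. A block met but not filled by \<open>A\<close> has an
  internal edge crossing \<open>A\<close>, because the graph of a face is connected. If \<open>a\<close> is a block filled
  by \<open>A\<close> and \<open>b\<close> an adjacent block that is not, then any vertex of \<open>b\<close> outside \<open>A\<close> has a neighbour
  in \<open>a\<close>, because the union of the two blocks is a face and one of them is the top level of a
  coordinate on it. These edges are distinct, so the isoperimetric inequality of the hypercube of
  blocks bounds the number of crossing edges from below by a number of blocks covering \<open>A\<close> or its
  complement.

  For a random \<open>S\<close>, choose \<open>k\<close> such that the expected number of points per block lies between \<open>d\<close>
  and \<open>2 d\<close>; union bounds show that with high probability no block is empty and none has more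
  than \<open>12 d\<close> points. At the extremes, \<open>k = 0\<close> needs no lower and \<open>k = d\<close> no upper bound.
\<close>

section \<open>Edges of 0/1 polytopes\<close>

text \<open>The union of \<open>{x. c x < 0}\<close> and \<open>convex hull T\<close> is convex:
  \<open>c\<close> is nonpositive on it, so a proper combination involving a negative value stays
  negative. It contains \<open>S\<close>, hence also \<open>convex hull S\<close>.\<close>

lemma convex_hull_affine_le_zero:
  fixes c :: "'a::real_vector \<Rightarrow> real"
  assumes aff: "\<And>x y a b. \<lbrakk>0 \<le> a; 0 \<le> b; a + b = 1\<rbrakk> \<Longrightarrow> c (a *\<^sub>R x + b *\<^sub>R y) = a * c x + b * c y"
    and zero: "\<And>x. x \<in> T \<Longrightarrow> c x = 0" and neg: "\<And>x. x \<in> S - T \<Longrightarrow> c x < 0"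
  shows "x \<in> convex hull T \<Longrightarrow> c x = 0"
    and "x \<in> convex hull S \<Longrightarrow> c x < 0 \<or> x \<in> convex hull T"
proof -
  have "convex {x. c x = 0}"
    by (rule convexI) (simp add: aff)
  then have Z: "convex hull T \<subseteq> {x. c x = 0}"
    using zero by (intro hull_minimal) auto
  then show "x \<in> convex hull T \<Longrightarrow> c x = 0" by auto
  have "convex {x. c x < 0 \<or> x \<in> convex hull T}"
  proof (rule convexI)
    fix x y and a b :: real
    assume xy: "x \<in> {x. c x < 0 \<or> x \<in> convex hull T}" "y \<in> {x. c x < 0 \<or> x \<in> convex hull T}"
      and ab: "0 \<le> a" "0 \<le> b" "a + b = 1"
    have le: "c x \<le> 0" "c y \<le> 0" using xy Z by auto
    consider "a = 0" | "b = 0" | "a > 0" "b > 0" "x \<in> convex hull T" "y \<in> convex hull T"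
      | "a > 0" "b > 0" "c x < 0 \<or> c y < 0"
      using ab xy by fastforce
    then show "a *\<^sub>R x + b *\<^sub>R y \<in> {x. c x < 0 \<or> x \<in> convex hull T}"
    proof cases
      case 3
      then show ?thesis using ab convexD[OF convex_convex_hull] by blast
    next
      case 4
      then have "a * c x + b * c y < 0"
        using le mult_pos_neg[of a "c x"] mult_pos_neg[of b "c y"]
          mult_nonneg_nonpos[of a "c x"] mult_nonneg_nonpos[of b "c y"] by auto
      then show ?thesis using ab by (simp add: aff)
    qed (use ab xy in auto)
  qed
  then have "convex hull S \<subseteq> {x. c x < 0 \<or> x \<in> convex hull T}"
    using neg hull_subset[of T convex] by (intro hull_minimal) auto
  then show "x \<in> convex hull S \<Longrightarrow> c x < 0 \<or> x \<in> convex hull T" by auto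
qed

text \<open>On \<open>convex hull S\<close> the functional \<open>c\<close> is at most 0, with zero
  set \<open>convex hull T\<close>. If \<open>c\<close> vanishes inside a segment, it vanishes at
  both ends. The second conclusion identifies the vertices of the face, through which edges are
  encoded.\<close>

lemma exposed_face_of_convex_hull:
  fixes c :: "'a::real_vector \<Rightarrow> real"
  assumes aff: "\<And>x y a b. \<lbrakk>0 \<le> a; 0 \<le> b; a + b = 1\<rbrakk> \<Longrightarrow> c (a *\<^sub>R x + b *\<^sub>R y) = a * c x + b * c y"
    and zero: "\<And>x. x \<in> T \<Longrightarrow> c x = 0" and neg: "\<And>x. x \<in> S - T \<Longrightarrow> c x < 0"
    and "T \<subseteq> S"
  shows "convex hull T face_of convex hull S" and "convex hull T \<inter> S = T"
proof -
  have hull1: "c x = 0" if "x \<in> convex hull T" for x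
    by (rule convex_hull_affine_le_zero(1)[of c T S]) (fact aff zero neg that)+
  have hull2: "c x < 0 \<or> x \<in> convex hull T" if "x \<in> convex hull S" for x
    by (rule convex_hull_affine_le_zero(2)[of c T S]) (fact aff zero neg that)+
  show "convex hull T face_of convex hull S"
    unfolding face_of_def
  proof (intro conjI ballI impI)
    show "convex hull T \<subseteq> convex hull S" using \<open>T \<subseteq> S\<close> by (rule hull_mono)
    fix a b x assume *: "a \<in> convex hull S" "b \<in> convex hull S" "x \<in> convex hull T" "x \<in> open_segment a b"
    then obtain u where u: "0 < u" "u < 1" "x = (1 - u) *\<^sub>R a + u *\<^sub>R b"
      by (auto simp: in_segment)
    have "c x = 0" using hull1 * by blast
    then have 0: "(1 - u) * c a + u * c b = 0" using u by (simp add: aff)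
    have le: "c y \<le> 0" if "y \<in> convex hull S" for y
      using hull1[of y] hull2[of y] that by fastforce
    have "(1 - u) * c a \<le> 0" "u * c b \<le> 0"
      using u le * by (auto intro!: mult_nonneg_nonpos)
    then have "(1 - u) * c a = 0" "u * c b = 0" using 0 by linarith+
    then have "c a = 0" "c b = 0" using u by auto
    then show "a \<in> convex hull T" "b \<in> convex hull T"
      using hull2[of a] hull2[of b] * by auto
  qed (rule convex_convex_hull)
  show "convex hull T \<inter> S = T"
  proof (intro equalityI subsetI)
    fix x assume "x \<in> convex hull T \<inter> S"
    then have "c x = 0" "x \<in> S" using hull1 by auto
    then show "x \<in> T" using neg[of x] by auto
  qed (use \<open>T \<subseteq> S\<close> in \<open>auto intro: hull_inc\<close>)
qed

text \<open>
  On the cube, \<open>(1 - 2 * v j) * (x j - v j)\<close> is 1 if \<open>x\<close> and \<open>v\<close> differ at \<open>j\<close> and 0 otherwise.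
\<close>

definition cube_affine :: "nat \<Rightarrow> (nat \<Rightarrow> real) \<Rightarrow> (nat \<Rightarrow> real) \<Rightarrow> (nat \<Rightarrow> real) \<Rightarrow> real"
  where "cube_affine d v \<beta> x = (\<Sum>j<d. \<beta> j * ((1 - 2 * v j) * (x j - v j)))"

lemma cube_affine_convex_comb:
  assumes "a + b = 1"
  shows "cube_affine d v \<beta> (a *\<^sub>R x + b *\<^sub>R y) = a * cube_affine d v \<beta> x + b * cube_affine d v \<beta> y"
proof -
  have "\<beta> j * ((1 - 2 * v j) * ((a *\<^sub>R x + b *\<^sub>R y) j - v j)) =
     a * (\<beta> j * ((1 - 2 * v j) * (x j - v j))) + b * (\<beta> j * ((1 - 2 * v j) * (y j - v j)))" for j
  proof -
    have b: "b = 1 - a" using assms by simp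
    show ?thesis unfolding b by (simp add: scaleR_fun_def algebra_simps)
  qed
  then show ?thesis unfolding cube_affine_def by (simp add: sum.distrib sum_distrib_left)
qed

text \<open>Its cardinality is the Hamming distance. For cube points,
  \<open>diff_coords x v \<subseteq> diff_coords w v\<close> says that \<open>x\<close> lies in the
  smallest face of the cube containing \<open>v\<close> and \<open>w\<close>.\<close>

definition diff_coords :: "(nat \<Rightarrow> real) \<Rightarrow> (nat \<Rightarrow> real) \<Rightarrow> nat set"
  where "diff_coords x y = {j. x j \<noteq> y j}"

lemma diff_coords_cube01: "x \<in> cube01 d \<Longrightarrow> y \<in> cube01 d \<Longrightarrow> diff_coords x y \<subseteq> {..<d}"
  unfolding cube01_def diff_coords_def by (intro subsetI) (simp, metis not_less)

lemma finite_diff_coords: "x \<in> cube01 d \<Longrightarrow> y \<in> cube01 d \<Longrightarrow> finite (diff_coords x y)"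
  using diff_coords_cube01[of x d y] finite_subset[of _ "{..<d}"] by simp

lemma diff_coords_commute: "diff_coords x y = diff_coords y x"
  by (auto simp: diff_coords_def)

lemma diff_coords_empty_iff: "diff_coords x y = {} \<longleftrightarrow> x = y"
  by (auto simp: diff_coords_def)

lemma cube_affine_cube01:
  assumes "v \<in> cube01 d" "x \<in> cube01 d"
  shows "cube_affine d v \<beta> x = (\<Sum>j\<in>diff_coords x v. \<beta> j)"
proof -
  have "cube_affine d v \<beta> x = (\<Sum>j<d. if j \<in> diff_coords x v then \<beta> j else 0)"
    unfolding cube_affine_def using assms
    by (intro sum.cong refl) (force simp: cube01_def diff_coords_def)
  also have "\<dots> = (\<Sum>j\<in>{..<d} \<inter> diff_coords x v. \<beta> j)"
    by (simp add: sum.If_cases)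
  finally show ?thesis
    using diff_coords_cube01[OF assms(2,1)] by (simp add: Int_absorb1)
qed

text \<open>With all weights -1 the functional is minus the Hamming distance to \<open>v\<close>,
  which exposes \<open>v\<close> alone.\<close>

lemma polytope_vertices_cube01:
  assumes "S \<subseteq> cube01 d"
  shows "polytope_vertices (convex hull S) = S"
proof -
  have "v extreme_point_of convex hull S" if v: "v \<in> S" for v
  proof -
    have "cube_affine d v (\<lambda>_. -1) x < 0" if "x \<in> S - {v}" for x
    proof -
      have "card (diff_coords x v) > 0"
        using that v assms by (auto simp: card_gt_0_iff diff_coords_empty_iff intro!: finite_diff_coords)
      then show ?thesis
        using that v assms by (auto simp: cube_affine_cube01 subset_iff)
    qed
    then have "convex hull {v} face_of convex hull S"
      using v by (intro exposed_face_of_convex_hull(1)[of "cube_affine d v (\<lambda>_. -1)"])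
        (auto simp: cube_affine_convex_comb, simp add: cube_affine_def)
    then show ?thesis by (simp add: face_of_singleton)
  qed
  then show ?thesis
    unfolding polytope_vertices_def using extreme_point_of_convex_hull by blast
qed

text \<open>
  The points of \<open>S\<close> in the smallest face of the cube containing \<open>v\<close> and \<open>w\<close> span a pyramid with
  apex \<open>w\<close> over a base containing \<open>v\<close>, and the apex is joined to every vertex of the base.
  The weights \<open>\<beta>\<close> below penalise the distance to \<open>v\<close>, reward coordinate \<open>i\<close> just enough to
  lift \<open>w\<close> to the level of \<open>v\<close>, and cancel that reward outside the smallest face.
\<close>

lemma polytope_edge_cube01I:
  assumes S: "S \<subseteq> cube01 d" and vw: "v \<in> S" "w \<in> S" and i: "v i \<noteq> w i"
    and uniq: "\<And>x. x \<in> S \<Longrightarrow> diff_coords x v \<subseteq> diff_coords w v \<Longrightarrow> x i = w i \<Longrightarrow> x = w"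
  shows "{v, w} \<in> polytope_edges (convex hull S)"
proof -
  define D where "D = real (card (diff_coords w v))"
  define \<beta> where "\<beta> j = (if j = i then D else 0) - (if j \<in> diff_coords w v then 0 else D) - 1" for j
  define c where "c = cube_affine d v \<beta>"
  have cube: "v \<in> cube01 d" "w \<in> cube01 d" using S vw by auto
  have iw: "i \<in> diff_coords w v" using i by (auto simp: diff_coords_def)
  have c_eq: "c x = (if i \<in> diff_coords x v then D else 0)
      - D * card (diff_coords x v - diff_coords w v) - card (diff_coords x v)" if "x \<in> cube01 d" for x
  proof -
    have fin: "finite (diff_coords x v)" using that cube finite_diff_coords by blast
    have "c x = (\<Sum>j\<in>diff_coords x v. \<beta> j)"
      unfolding c_def using cube that by (simp add: cube_affine_cube01)
    also have "\<dots> = (\<Sum>j\<in>diff_coords x v. if j = i then D else 0)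
       - (\<Sum>j\<in>diff_coords x v. if j \<in> diff_coords w v then 0 else D) - card (diff_coords x v)"
      unfolding \<beta>_def by (simp add: sum_subtractf)
    also have "(\<Sum>j\<in>diff_coords x v. if j \<in> diff_coords w v then 0 else D)
        = D * card (diff_coords x v - diff_coords w v)"
      using fin by (simp add: sum.If_cases Diff_eq)
    finally show ?thesis using fin by simp
  qed
  have D0: "D \<ge> 0" by (simp add: D_def)
  have aff: "c (a *\<^sub>R x + b *\<^sub>R y) = a * c x + b * c y" if "a + b = 1" for a b x y
    unfolding c_def using that by (rule cube_affine_convex_comb)
  have cv: "c v = 0" by (simp add: c_def cube_affine_def)
  have cw: "c w = 0" using iw by (simp add: c_eq[OF cube(2)] D_def)
  have neg: "c x < 0" if x: "x \<in> S - {v, w}" for x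
  proof -
    have xc: "x \<in> cube01 d" using x S by auto
    have fin: "finite (diff_coords x v)" using xc cube finite_diff_coords by blast
    have pos: "card (diff_coords x v) > 0"
      using x fin by (auto simp: card_gt_0_iff diff_coords_empty_iff)
    show ?thesis
    proof (cases "i \<in> diff_coords x v")
      case False
      have "D * card (diff_coords x v - diff_coords w v) \<ge> 0" using D0 by simp
      then show ?thesis using pos False by (simp add: c_eq[OF xc])
    next
      case True
      have "x i = w i"
      proof (cases "i < d")
        case True
        then have "x i \<in> {0,1}" "w i \<in> {0,1}" "v i \<in> {0,1}" using xc cube by (auto simp: cube01_def)
        then show ?thesis using i \<open>i \<in> diff_coords x v\<close> by (auto simp: diff_coords_def)
      qed (use xc cube in \<open>auto simp: cube01_def\<close>)
      then have "\<not> diff_coords x v \<subseteq> diff_coords w v" using uniq x by blast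
      then have "card (diff_coords x v - diff_coords w v) \<ge> 1"
        using fin by (simp add: Suc_le_eq card_gt_0_iff)
      \<comment> \<open>A single coordinate outside the smallest face costs \<open>D\<close>, which
        cancels the reward for coordinate \<open>i\<close>; the distance term then makes
        \<open>c x\<close> negative.\<close>
      then have "D * card (diff_coords x v - diff_coords w v) \<ge> D * 1"
        using D0 by (intro mult_left_mono) auto
      then show ?thesis using pos True by (simp add: c_eq[OF xc])
    qed
  qed
  have zero: "c x = 0" if "x \<in> {v, w}" for x using that cv cw by auto
  have "{v, w} \<subseteq> S" using vw by simp
  have "convex hull {v, w} face_of convex hull S" "convex hull {v, w} \<inter> S = {v, w}"
    using exposed_face_of_convex_hull[of c "{v, w}" S] aff zero neg \<open>{v, w} \<subseteq> S\<close> by blast+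
  moreover have "v \<noteq> w" using i by auto
  then have "has_aff_dim (convex hull {v, w}) 1"
    unfolding has_aff_dim_def by (intro exI[of _ "{v, w}"]) simp
  ultimately show ?thesis
    unfolding polytope_edges_def polytope_vertices_cube01[OF S] by blast
qed

section \<open>Edges inside a block and between adjacent blocks\<close>

lemma cube01_coord: "x \<in> cube01 d \<Longrightarrow> x j = 0 \<or> x j = 1"
  by (cases "j < d") (auto simp: cube01_def)

text \<open>In the smallest face containing \<open>v\<close> and \<open>w\<close>, the point
  \<open>w\<close> is antipodal to \<open>v\<close>, hence the only point at maximal
  distance.\<close>

lemma card_diff_coords_less:
  assumes "x \<in> cube01 d" "v \<in> cube01 d" "w \<in> cube01 d"
    and sub: "diff_coords x v \<subseteq> diff_coords w v" and "x \<noteq> w"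
  shows "card (diff_coords x v) < card (diff_coords w v)"
proof (rule psubset_card_mono)
  show "finite (diff_coords w v)" using assms finite_diff_coords by blast
  obtain j where j: "x j \<noteq> w j" using \<open>x \<noteq> w\<close> by auto
  then have "j \<in> diff_coords w v" "j \<notin> diff_coords x v"
    using subsetD[OF sub, of j] cube01_coord[of x d j] cube01_coord[of v d j] cube01_coord[of w d j]
      assms(1-3) by (auto simp: diff_coords_def)
  then show "diff_coords x v \<subset> diff_coords w v" using sub by auto
qed

lemma diff_coords_subset_swap:
  "diff_coords x v \<subseteq> diff_coords w v \<Longrightarrow> diff_coords x w \<subseteq> diff_coords v w"
  unfolding diff_coords_def by (intro subsetI) (simp, metis (mono_tags, lifting) mem_Collect_eq subsetD)

text \<open>Encoding the first \<open>k\<close> coordinates as a subset of \<open>{..<k}\<close>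
  turns block labels into vertices of a hypercube, with adjacency a one-element symmetric
  difference.\<close>

definition ones_below :: "nat \<Rightarrow> (nat \<Rightarrow> real) \<Rightarrow> nat set"
  where "ones_below k x = {i. i < k \<and> x i = 1}"

lemma ones_below_agree_iff:
  assumes "x \<in> cube01 d" "y \<in> cube01 d" "j < k"
  shows "x j = y j \<longleftrightarrow> (j \<in> ones_below k x \<longleftrightarrow> j \<in> ones_below k y)"
  using cube01_coord[of x d j] cube01_coord[of y d j] assms by (auto simp: ones_below_def)

lemma ones_below_eqI:
  "(\<And>j. j < k \<Longrightarrow> x j = y j) \<Longrightarrow> ones_below k x = ones_below k y"
  by (auto simp: ones_below_def)

text \<open>
  A block is the set of points with a given value of \<open>ones_below k\<close>. For a pair of points at minimal
  distance on the two sides of \<open>A\<close>, the smallest face of the cube contains no further point of \<open>S\<close>.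
\<close>

lemma polytope_edge_within_block:
  assumes S: "S \<subseteq> cube01 d" and "A \<subseteq> S"
    and u: "u \<in> A" "ones_below k u = a" and v: "v \<in> S - A" "ones_below k v = a"
  shows "\<exists>u\<in>A. \<exists>v\<in>S - A. ones_below k u = a \<and> ones_below k v = a \<and>
    {u, v} \<in> polytope_edges (convex hull S)"
proof -
  define Q where "Q = (\<lambda>(u, v). u \<in> A \<and> v \<in> S - A \<and> ones_below k u = a \<and> ones_below k v = a)"
  have "Q (u, v)" using u v by (simp add: Q_def)
  then obtain z where z: "Q z"
    and min: "\<And>z'. Q z' \<Longrightarrow> card (case_prod diff_coords z) \<le> card (case_prod diff_coords z')"
    using ex_has_least_nat[of Q "(u, v)" "\<lambda>z. card (case_prod diff_coords z)"] by blast
  obtain p q where pq: "z = (p, q)" by fastforce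
  have p: "p \<in> A" "ones_below k p = a" and q: "q \<in> S - A" "ones_below k q = a"
    using z by (auto simp: Q_def pq)
  have cube: "p \<in> cube01 d" "q \<in> cube01 d" using p q assms by auto
  have only: "x = p \<or> x = q" if x: "x \<in> S" "diff_coords x p \<subseteq> diff_coords q p" for x
  proof (rule ccontr)
    assume ne: "\<not> (x = p \<or> x = q)"
    have xc: "x \<in> cube01 d" using x S by auto
    have "x j = p j" if "j < k" for j
      using ones_below_agree_iff[OF cube(2,1) that] p q x by (auto simp: diff_coords_def)
    then have xa: "ones_below k x = a"
      using ones_below_eqI[of k x p] p by auto
    \<comment> \<open>Replacing \<open>p\<close> by \<open>x\<close> if \<open>x\<close> is in
      \<open>A\<close>, and \<open>q\<close> by \<open>x\<close> otherwise, gives a closer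
      admissible pair.\<close>
    show False
    proof (cases "x \<in> A")
      case True
      then have "card (diff_coords p q) \<le> card (diff_coords x q)"
        using min[of "(x, q)"] xa q by (auto simp: Q_def pq)
      then show False
        using card_diff_coords_less[OF xc cube(2,1) diff_coords_subset_swap[OF x(2)]] ne by auto
    next
      case False
      then have "card (diff_coords p q) \<le> card (diff_coords p x)"
        using min[of "(p, x)"] xa p x by (auto simp: Q_def pq)
      then show False
        using card_diff_coords_less[OF xc cube x(2)] ne by (auto simp: diff_coords_commute)
    qed
  qed
  have "p \<noteq> q" using p q by auto
  then obtain i where i: "p i \<noteq> q i" by auto
  have "{p, q} \<in> polytope_edges (convex hull S)"
    using only i p q \<open>A \<subseteq> S\<close> by (intro polytope_edge_cube01I[OF S, of p q i]) auto
  then show ?thesis using p q by blast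
qed

text \<open>Take \<open>z\<close> in the block of \<open>w\<close> nearest to \<open>v\<close>.
  Below \<open>k\<close>, \<open>v\<close> and \<open>z\<close> differ only at \<open>i\<close>, so
  a point of their smallest face sharing coordinate \<open>i\<close> with \<open>z\<close> lies in
  the same block as \<open>z\<close>. Being no nearer to \<open>v\<close>, it must be the antipode
  \<open>z\<close>, and the edge criterion applies.\<close>

lemma polytope_edge_to_adjacent_block:
  assumes S: "S \<subseteq> cube01 d" and "v \<in> S" "w \<in> S" and i: "i < k"
    and adj: "sym_diff (ones_below k w) (ones_below k v) = {i}"
  shows "\<exists>x\<in>S. ones_below k x = ones_below k w \<and> {v, x} \<in> polytope_edges (convex hull S)"
proof -
  define Q where "Q x \<longleftrightarrow> x \<in> S \<and> ones_below k x = ones_below k w" for x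
  have "Q w" using assms by (simp add: Q_def)
  then obtain z where z: "Q z" and min: "\<And>x. Q x \<Longrightarrow> card (diff_coords z v) \<le> card (diff_coords x v)"
    using ex_has_least_nat[of Q w "\<lambda>x. card (diff_coords x v)"] by blast
  have cube: "v \<in> cube01 d" "z \<in> cube01 d" using z S assms by (auto simp: Q_def)
  have zi: "v i \<noteq> z i"
    using ones_below_agree_iff[OF cube i] adj z by (auto simp: Q_def)
  have zj: "v j = z j" if "j < k" "j \<noteq> i" for j
    using ones_below_agree_iff[OF cube that(1)] adj z that by (auto simp: Q_def)
  have "x = z" if x: "x \<in> S" "diff_coords x v \<subseteq> diff_coords z v" "x i = z i" for x
  proof (rule ccontr)
    assume "x \<noteq> z"
    have xc: "x \<in> cube01 d" using x S by auto
    have "x j = z j" if "j < k" for j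
      using zj[OF that] x(3) subsetD[OF x(2), of j] by (cases "j = i") (auto simp: diff_coords_def)
    then have "Q x" using x(1) z ones_below_eqI[of k x z] by (auto simp: Q_def)
    then show False
      using min card_diff_coords_less[OF xc cube x(2) \<open>x \<noteq> z\<close>] by (simp add: leD)
  qed
  then have "{v, z} \<in> polytope_edges (convex hull S)"
    using zi z assms by (intro polytope_edge_cube01I[OF S, of v z i]) (auto simp: Q_def)
  then show ?thesis using z by (auto simp: Q_def)
qed

section \<open>Expansion from a partition into small blocks\<close>

text \<open>Boundary edges are oriented out of \<open>X\<close>, to be compared with the pairs of
  block labels of polytope edges leaving \<open>A\<close>.\<close>

definition hypercube_boundary :: "nat \<Rightarrow> nat set set \<Rightarrow> (nat set \<times> nat set) set"
  where "hypercube_boundary k X =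
    {(a, b). a \<in> X \<and> b \<in> Pow {..<k} - X \<and> (\<exists>i<k. sym_diff a b = {i})}"

lemma finite_hypercube_boundary: "X \<subseteq> Pow {..<k} \<Longrightarrow> finite (hypercube_boundary k X)"
  by (rule finite_subset[of _ "Pow {..<k} \<times> Pow {..<k}"]) (auto simp: hypercube_boundary_def)

text \<open>Induction on the dimension: the last coordinate splits \<open>X\<close> into slices
  \<open>X0\<close> and \<open>X1\<close>. Besides the boundaries of the slices, the boundary
  contains one edge in the last direction for each point in exactly one slice.\<close>

lemma hypercube_edge_isoperimetry:
  "X \<subseteq> Pow {..<k} \<Longrightarrow> min (card X) (2 ^ k - card X) \<le> card (hypercube_boundary k X)"
proof (induction k arbitrary: X)
  case 0
  then have "card X \<le> card {{}::nat set}" by (intro card_mono) auto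
  then show ?case by (auto simp: min_def)
next
  case (Suc k)
  define X0 where "X0 = {a \<in> X. k \<notin> a}"
  define X1 where "X1 = {a. a \<subseteq> {..<k} \<and> insert k a \<in> X}"
  define up where "up = (\<lambda>(a, b). (insert k a, insert k b))"
  have sub: "X0 \<subseteq> Pow {..<k}" "X1 \<subseteq> Pow {..<k}"
    using Suc.prems by (auto simp: X0_def X1_def lessThan_Suc subset_insert)
  have fin: "finite X0" "finite X1" using sub finite_subset by (metis finite_Pow_iff finite_lessThan)+
  have nk: "k \<notin> a" if "a \<subseteq> {..<k}" for a using that by auto
  have "X = X0 \<union> insert k ` X1"
  proof -
    have "a \<in> insert k ` X1" if "a \<in> X" "k \<in> a" for a
      using that Suc.prems by (intro image_eqI[of _ _ "a - {k}"])
        (auto simp: X1_def insert_absorb lessThan_Suc)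
    then show ?thesis by (auto simp: X0_def X1_def)
  qed
  moreover have "X0 \<inter> insert k ` X1 = {}" by (auto simp: X0_def)
  moreover have inj_k: "inj_on (insert k) (Pow {..<k})"
    by (intro inj_onI) (metis nk PowD insert_ident)
  ultimately have card_X: "card X = card X0 + card X1"
    using fin sub by (simp add: card_Un_disjoint card_image inj_on_subset[OF inj_k])
  \<comment> \<open>The four families of boundary edges are disjoint because they differ in which of
    the two ends contain \<open>k\<close>.\<close>
  let ?B0 = "hypercube_boundary k X0" and ?B1 = "up ` hypercube_boundary k X1"
  let ?C0 = "(\<lambda>a. (a, insert k a)) ` (X0 - X1)" and ?C1 = "(\<lambda>a. (insert k a, a)) ` (X1 - X0)"
  have B0: "?B0 \<subseteq> {(a, b). k \<notin> a \<and> k \<notin> b}"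
    using sub by (auto simp: hypercube_boundary_def)
  have B1: "?B1 \<subseteq> {(a, b). k \<in> a \<and> k \<in> b}" by (auto simp: up_def)
  have C0: "?C0 \<subseteq> {(a, b). k \<notin> a \<and> k \<in> b}" by (auto simp: X0_def)
  have C1: "?C1 \<subseteq> {(a, b). k \<in> a \<and> k \<notin> b}" by (auto simp: X1_def)
  have "?B0 \<union> ?B1 \<union> ?C0 \<union> ?C1 \<subseteq> hypercube_boundary (Suc k) X"
  proof (intro Un_least subsetI)
    fix z assume "z \<in> ?B0"
    then show "z \<in> hypercube_boundary (Suc k) X"
      using nk by (fastforce simp: hypercube_boundary_def X0_def less_Suc_eq)
  next
    fix z assume "z \<in> ?B1"
    then obtain a b i where z: "z = (insert k a, insert k b)" "a \<in> X1" "b \<subseteq> {..<k}" "b \<notin> X1"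
      "i < k" "sym_diff a b = {i}"
      by (auto simp: hypercube_boundary_def up_def)
    have "sym_diff (insert k a) (insert k b) = sym_diff a b"
      using z sub nk by blast
    then have "\<exists>i<Suc k. sym_diff (insert k a) (insert k b) = {i}" using z by auto
    then show "z \<in> hypercube_boundary (Suc k) X"
      unfolding hypercube_boundary_def using z by (auto simp: X1_def less_Suc_eq)
  next
    fix z assume "z \<in> ?C0"
    then obtain a where z: "z = (a, insert k a)" "a \<in> X0" "a \<notin> X1" by auto
    have "sym_diff a (insert k a) = {k}" using z by (auto simp: X0_def)
    then have "\<exists>i<Suc k. sym_diff a (insert k a) = {i}" by blast
    moreover have a: "a \<subseteq> {..<k}" using z sub by auto
    moreover have "a \<in> X" "insert k a \<notin> X" using z a by (simp_all add: X0_def X1_def)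
    ultimately show "z \<in> hypercube_boundary (Suc k) X"
      unfolding hypercube_boundary_def z lessThan_Suc by blast
  next
    fix z assume "z \<in> ?C1"
    then obtain a where z: "z = (insert k a, a)" "a \<in> X1" "a \<notin> X0" by auto
    have ak: "a \<subseteq> {..<k}" using z sub by auto
    have "sym_diff (insert k a) a = {k}" using ak by auto
    then have "\<exists>i<Suc k. sym_diff (insert k a) a = {i}" by blast
    moreover have "insert k a \<in> X" "a \<notin> X" using z ak nk[OF ak] by (simp_all add: X0_def X1_def)
    ultimately show "z \<in> hypercube_boundary (Suc k) X"
      using ak unfolding hypercube_boundary_def z lessThan_Suc by blast
  qed
  then have "card (?B0 \<union> ?B1 \<union> ?C0 \<union> ?C1) \<le> card (hypercube_boundary (Suc k) X)"
    using finite_hypercube_boundary[OF Suc.prems] by (rule card_mono[rotated])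
  moreover have "card (?B0 \<union> ?B1 \<union> ?C0 \<union> ?C1) = card ?B0 + card ?B1 + card ?C0 + card ?C1"
  proof -
    have fB: "finite ?B0" "finite ?B1" using finite_hypercube_boundary sub by blast+
    have fC: "finite ?C0" "finite ?C1" using fin by auto
    have disj: "P \<inter> Q = {}" if "P \<subseteq> {(a, b). p a b}" "Q \<subseteq> {(a, b). q a b}" "\<And>a b. \<not> (p a b \<and> q a b)"
      for P Q :: "(nat set \<times> nat set) set" and p q using that by fastforce
    have "?B0 \<inter> ?B1 = {}" by (rule disj[OF B0 B1]) auto
    moreover have "?B0 \<inter> ?C0 = {}" by (rule disj[OF B0 C0]) auto
    moreover have "?B0 \<inter> ?C1 = {}" by (rule disj[OF B0 C1]) auto
    moreover have "?B1 \<inter> ?C0 = {}" by (rule disj[OF B1 C0]) auto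
    moreover have "?B1 \<inter> ?C1 = {}" by (rule disj[OF B1 C1]) auto
    moreover have "?C0 \<inter> ?C1 = {}" by (rule disj[OF C0 C1]) auto
    ultimately show ?thesis using fB fC by (simp add: card_Un_disjoint Int_Un_distrib2)
  qed
  moreover have "card ?B1 = card (hypercube_boundary k X1)"
  proof (rule card_image, rule inj_on_subset)
    show "hypercube_boundary k X1 \<subseteq> Pow {..<k} \<times> Pow {..<k}"
      using sub by (auto simp: hypercube_boundary_def)
    show "inj_on up (Pow {..<k} \<times> Pow {..<k})"
      using inj_k by (auto simp: up_def inj_on_def)
  qed
  moreover have "card ?C0 = card (X0 - X1)" "card ?C1 = card (X1 - X0)"
    by (auto intro!: card_image inj_onI)
  ultimately have "card ?B0 + card (hypercube_boundary k X1) + card (X0 - X1) + card (X1 - X0)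
      \<le> card (hypercube_boundary (Suc k) X)" by linarith
  \<comment> \<open>With truncated subtraction one of the left sides is 0, and their sum is the
    absolute difference.\<close>
  moreover have "card X0 - card X1 \<le> card (X0 - X1)" "card X1 - card X0 \<le> card (X1 - X0)"
    using fin by (auto intro: diff_card_le_card_Diff)
  moreover have "min (card X0) (2 ^ k - card X0) \<le> card ?B0"
    "min (card X1) (2 ^ k - card X1) \<le> card (hypercube_boundary k X1)"
    using Suc.IH sub by auto
  moreover have "card X0 \<le> 2 ^ k" "card X1 \<le> 2 ^ k"
    using card_mono[OF _ sub(1)] card_mono[OF _ sub(2)] by (auto simp: card_Pow)
  \<comment> \<open>If both slices are at most half full, or both at least half full, the two slice
    bounds suffice. Otherwise they and the absolute difference add up to \<open>2 ^ k\<close>, which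
    is at least the required minimum.\<close>
  ultimately show ?case
    unfolding card_X power_Suc by linarith
qed

section \<open>From block sizes to edge expansion\<close>

lemma polytope_edge_expansion_blocks:
  assumes S: "S \<subseteq> cube01 d" and "m \<ge> 1"
    and ne: "\<And>a. a \<subseteq> {..<k} \<Longrightarrow> \<exists>x\<in>S. ones_below k x = a"
    and le: "\<And>a. a \<subseteq> {..<k} \<Longrightarrow> card {x \<in> S. ones_below k x = a} \<le> m"
  shows "polytope_edge_expansion (convex hull S) \<ge> ereal (1 / real m)"
proof -
  have finS: "finite S" using S finite_cube01 finite_subset by blast
  let ?E = "polytope_edges (convex hull S)"
  have "ereal (1 / real m) \<le> ereal (card (edge_boundary S ?E A) / card A)"
    if A: "A \<subseteq> S" "1 \<le> card A" "real (card A) \<le> real (card S) / 2" for A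
  proof -
    have finA: "finite A" using A finS finite_subset by blast
    \<comment> \<open>\<open>X\<close> labels the blocks filled by \<open>A\<close>,
      \<open>M\<close> those met but not filled. \<open>D\<close> holds the crossing edges oriented
      out of \<open>A\<close>; counting their images under \<open>\<phi>\<close> avoids counting an
      edge twice.\<close>
    define X where "X = {a \<in> Pow {..<k}. {x \<in> S. ones_below k x = a} \<subseteq> A}"
    define M where "M = {a \<in> Pow {..<k}. a \<notin> X \<and> (\<exists>x\<in>A. ones_below k x = a)}"
    define D where "D = {(u, v). u \<in> A \<and> v \<in> S - A \<and> {u, v} \<in> ?E}"
    define \<phi> where "\<phi> = (\<lambda>(u, v). (ones_below k u, ones_below k v))"
    have subs: "X \<subseteq> Pow {..<k}" "M \<subseteq> Pow {..<k}" "X \<inter> M = {}" by (auto simp: X_def M_def)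
    have fin: "finite X" "finite M" using subs by (meson finite_Pow_iff finite_lessThan finite_subset)+
    have finD: "finite D"
      by (rule finite_subset[of _ "S \<times> S"]) (use A finS in \<open>auto simp: D_def\<close>)
    have blk: "ones_below k x \<in> Pow {..<k}" for x by (auto simp: ones_below_def)
    have "edge_boundary S ?E A = (\<lambda>(u, v). {u, v}) ` D"
      by (auto simp: edge_boundary_def D_def)
    moreover have "inj_on (\<lambda>(u, v). {u, v}) D"
      by (auto simp: inj_on_def D_def doubleton_eq_iff)
    ultimately have card_bd: "card (edge_boundary S ?E A) = card D"
      by (simp add: card_image)
    have diag: "(\<lambda>a. (a, a)) ` M \<subseteq> \<phi> ` D"
    proof safe
      fix a assume "a \<in> M"
      then obtain u v where "u \<in> A" "ones_below k u = a" "v \<in> S - A" "ones_below k v = a"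
        by (auto simp: M_def X_def)
      from polytope_edge_within_block[OF S A(1) this] obtain u v where
        "u \<in> A" "v \<in> S - A" "ones_below k u = a" "ones_below k v = a" "{u, v} \<in> ?E" by blast
      then show "(a, a) \<in> \<phi> ` D"
        by (intro image_eqI[of _ _ "(u, v)"]) (auto simp: D_def \<phi>_def)
    qed
    have bd: "hypercube_boundary k X \<subseteq> \<phi> ` D"
    proof safe
      fix a b assume "(a, b) \<in> hypercube_boundary k X"
      then obtain i where ab: "a \<in> X" "b \<in> Pow {..<k} - X" "i < k" "sym_diff a b = {i}"
        by (auto simp: hypercube_boundary_def)
      then obtain v where v: "v \<in> S - A" "ones_below k v = b"
        by (auto simp: X_def)
      \<comment> \<open>Nonemptiness of the filled block provides a target for the edge from
        \<open>v\<close>.\<close>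
      obtain w where w: "w \<in> S" "ones_below k w = a" using ne ab subs by blast
      obtain x where "x \<in> S" "ones_below k x = a" "{v, x} \<in> ?E"
        using polytope_edge_to_adjacent_block[OF S, of v w i k] v w ab by auto
      moreover from this have "x \<in> A" using ab by (auto simp: X_def)
      ultimately show "(a, b) \<in> \<phi> ` D"
        using v by (intro image_eqI[of _ _ "(x, v)"]) (auto simp: D_def \<phi>_def insert_commute)
    qed
    have "hypercube_boundary k X \<inter> (\<lambda>a. (a, a)) ` M = {}"
      by (auto simp: hypercube_boundary_def)
    then have "card (hypercube_boundary k X) + card M = card (hypercube_boundary k X \<union> (\<lambda>a. (a, a)) ` M)"
      using fin finite_hypercube_boundary[OF subs(1)]
      by (simp add: card_Un_disjoint card_image inj_on_def)
    also have "\<dots> \<le> card (\<phi> ` D)"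
      using finD diag bd by (intro card_mono) auto
    also have "\<dots> \<le> card D" using finD by (rule card_image_le)
    finally have D: "min (card X) (2 ^ k - card X) + card M \<le> card D"
      using hypercube_edge_isoperimetry[OF subs(1)] by linarith
    have cover: "card C \<le> m * card Y"
      if "C \<subseteq> S" "Y \<subseteq> Pow {..<k}" "\<And>x. x \<in> C \<Longrightarrow> ones_below k x \<in> Y" for C Y
    proof -
      have finY: "finite Y" using that by (meson finite_Pow_iff finite_lessThan finite_subset)
      have "card C \<le> card (\<Union>a\<in>Y. {x \<in> S. ones_below k x = a})"
        using that finS finY by (intro card_mono) auto
      also have "\<dots> \<le> (\<Sum>a\<in>Y. card {x \<in> S. ones_below k x = a})"
        using finY by (rule card_UN_le)
      also have "\<dots> \<le> (\<Sum>a\<in>Y. m)" using that le by (intro sum_mono) auto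
      finally show ?thesis by (simp add: mult.commute)
    qed
    \<comment> \<open>If at most half of the blocks are filled, the blocks in \<open>X\<close> and
      \<open>M\<close> cover \<open>A\<close>. Otherwise the unfilled blocks cover
      \<open>S - A\<close>, which is at least as large as \<open>A\<close>.\<close>
    have "card A \<le> m * card D"
    proof (cases "2 * card X \<le> 2 ^ k")
      case True
      have "card A \<le> m * card (X \<union> M)"
        using A subs blk by (intro cover) (auto simp: M_def)
      also have "card (X \<union> M) \<le> card D"
        using D True subs fin by (simp add: card_Un_disjoint)
      finally show ?thesis by simp
    next
      case False
      have "card A \<le> card (S - A)"
        using A finA by (simp add: card_Diff_subset)
      also have "\<dots> \<le> m * card (Pow {..<k} - X)"
        using blk by (intro cover) (auto simp: X_def)
      also have "card (Pow {..<k} - X) \<le> card D"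
        using D False subs fin by (simp add: card_Diff_subset card_Pow)
      finally show ?thesis by simp
    qed
    then have "real (card A) \<le> real m * real (card D)"
      by (metis of_nat_le_iff of_nat_mult)
    then show ?thesis
      using card_bd A \<open>m \<ge> 1\<close> by (simp add: field_simps)
  qed
  then show ?thesis
    unfolding polytope_edge_expansion_def polytope_vertices_cube01[OF S] edge_expansion_def
    by (intro INF_greatest) auto
qed

section \<open>Random point sets\<close>

lemma card_cube01_block:
  assumes "k \<le> d" "a \<subseteq> {..<k}"
  shows "card {x \<in> cube01 d. ones_below k x = a} = 2 ^ (d - k)"
proof -
  define g where "g B = (\<lambda>i. if i \<in> a \<union> B then 1 else 0 :: real)" for B
  have "inj_on g (Pow {k..<d})"
  proof (rule inj_onI)
    fix B B' assume B: "B \<in> Pow {k..<d}" "B' \<in> Pow {k..<d}" and "g B = g B'"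
    then have "a \<union> B = a \<union> B'" by (auto simp: g_def fun_eq_iff split: if_splits)
    then have "(a \<union> B) \<inter> {k..<d} = (a \<union> B') \<inter> {k..<d}" by simp
    moreover have "a \<inter> {k..<d} = {}" using assms by fastforce
    ultimately show "B = B'" using B by blast
  qed
  moreover have "g ` Pow {k..<d} = {x \<in> cube01 d. ones_below k x = a}"
  proof (intro equalityI subsetI)
    fix x assume "x \<in> g ` Pow {k..<d}"
    then obtain B where "x = g B" "B \<subseteq> {k..<d}" by auto
    moreover have "a \<subseteq> {..<d}" "\<And>i. i \<in> a \<Longrightarrow> i < k" using assms by auto
    ultimately show "x \<in> {x \<in> cube01 d. ones_below k x = a}"
      by (auto simp: g_def cube01_def ones_below_def)
  next
    fix x assume x: "x \<in> {x \<in> cube01 d. ones_below k x = a}"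
    have "x = g {i \<in> {k..<d}. x i = 1}"
    proof
      fix i
      consider "i < k" | "k \<le> i" "i < d" | "d \<le> i" by linarith
      then show "x i = g {i \<in> {k..<d}. x i = 1} i"
        using x assms cube01_coord[of x d i]
        by cases (fastforce simp: g_def ones_below_def cube01_def)+
    qed
    then show "x \<in> g ` Pow {k..<d}" by blast
  qed
  ultimately show ?thesis by (metis card_image card_Pow card_atLeastLessThan finite_atLeastLessThan)
qed

text \<open>A weak Stirling bound: one term of the exponential series is at most
  \<open>exp m\<close>, and \<open>exp 1 \<le> 3\<close>.\<close>

lemma power_le_fact: "(real m / 3) ^ m \<le> fact m"
proof -
  have "real m ^ m / fact m \<le> exp (real m)"
  proof -
    have "(\<Sum>n\<in>{m}. real m ^ n /\<^sub>R fact n) \<le> (\<Sum>n. real m ^ n /\<^sub>R fact n)"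
      by (intro sum_le_suminf summable_exp_generic) auto
    then show ?thesis by (simp add: exp_def divide_inverse mult.commute)
  qed
  also have "exp (real m) = exp 1 ^ m" by (simp add: exp_of_nat_mult[symmetric])
  also have "\<dots> \<le> 3 ^ m" by (intro power_mono exp_le) auto
  finally show ?thesis by (simp add: power_divide field_simps)
qed

text \<open>At density \<open>q\<close> a block has \<open>q * 2 ^ (d - k)\<close> expected points,
  a number that doubles when \<open>k\<close> drops by one. The least exponent reaching
  \<open>d\<close> therefore overshoots by at most a factor 2.\<close>

lemma exists_block_dimension:
  fixes q :: real
  shows "\<exists>k\<le>d. (k = 0 \<or> q * 2 ^ (d - k) \<ge> real d) \<and> (k = d \<or> q * 2 ^ (d - k) \<le> 2 * real d)"
proof -
  define Q where "Q j \<longleftrightarrow> j = d \<or> q * 2 ^ j \<ge> real d" for j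
  define j where "j = (LEAST j. Q j)"
  have "Q d" by (simp add: Q_def)
  then have Qj: "Q j" and jd: "j \<le> d" unfolding j_def by (auto intro: LeastI Least_le)
  have "q * 2 ^ j \<le> 2 * real d" if "j \<noteq> 0"
  proof -
    have "\<not> Q (j - 1)" unfolding j_def using that j_def by (intro not_less_Least) auto
    then have "q * 2 ^ (j - 1) \<le> real d" by (simp add: Q_def)
    moreover have "(2::real) ^ j = 2 * 2 ^ (j - 1)" using that by (simp add: power_eq_if)
    ultimately show ?thesis by simp
  qed
  then show ?thesis
    using Qj jd by (intro exI[of _ "d - j"]) (cases "j = 0"; auto simp: Q_def)
qed

text \<open>Union bound over the \<open>m\<close>-element subsets of \<open>B\<close>, with
  \<open>card B choose m\<close> at most \<open>card B ^ m / fact m\<close>.\<close>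

lemma prob_subset_card_ge:
  fixes M :: "'a set pmf" and q :: real
  assumes "finite B" and "0 \<le> q"
    and sub: "\<And>T. T \<subseteq> B \<Longrightarrow> measure_pmf.prob M {U. T \<subseteq> U} \<le> q ^ card T"
  shows "measure_pmf.prob M {U. m \<le> card {x \<in> U. x \<in> B}} \<le> (card B * q) ^ m / fact m"
proof -
  have fin: "finite {T. T \<subseteq> B \<and> card T = m}" using \<open>finite B\<close> by auto
  have "{U. m \<le> card {x \<in> U. x \<in> B}} \<subseteq> (\<Union>T\<in>{T. T \<subseteq> B \<and> card T = m}. {U. T \<subseteq> U})"
  proof
    fix U assume "U \<in> {U. m \<le> card {x \<in> U. x \<in> B}}"
    then have "m \<le> card {x \<in> U. x \<in> B}" by simp
    then obtain T where "T \<subseteq> {x \<in> U. x \<in> B}" "card T = m"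
      by (rule obtain_subset_with_card_n)
    then show "U \<in> (\<Union>T\<in>{T. T \<subseteq> B \<and> card T = m}. {U. T \<subseteq> U})" by blast
  qed
  then have "measure_pmf.prob M {U. m \<le> card {x \<in> U. x \<in> B}} \<le>
      measure_pmf.prob M (\<Union>T\<in>{T. T \<subseteq> B \<and> card T = m}. {U. T \<subseteq> U})"
    by (intro measure_pmf.finite_measure_mono) auto
  also have "\<dots> \<le> (\<Sum>T\<in>{T. T \<subseteq> B \<and> card T = m}. measure_pmf.prob M {U. T \<subseteq> U})"
    using fin by (intro measure_UNION_le) auto
  also have "\<dots> \<le> (\<Sum>T\<in>{T. T \<subseteq> B \<and> card T = m}. q ^ m)"
    using sub by (intro sum_mono) auto
  also have "\<dots> = real (card B choose m) * q ^ m"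
    using n_subsets[OF \<open>finite B\<close>] by simp
  also have "\<dots> \<le> (real (card B) ^ m / fact m) * q ^ m"
  proof (rule mult_right_mono)
    have "real ((card B choose m) * fact m) \<le> real (card B ^ m)"
      by (rule of_nat_mono) (rule binomial_fact_pow)
    then show "real (card B choose m) \<le> real (card B) ^ m / fact m" by (simp add: field_simps)
  qed (use \<open>0 \<le> q\<close> in simp)
  finally show ?thesis by (simp add: power_mult_distrib)
qed

text \<open>
  Inclusion and avoidance bounds as for independent sampling with density \<open>q\<close> are all that is needed
  from the three models. The density may exceed 1, as in the balls-into-bins model with many balls.
\<close>

lemma expansion_prob:
  fixes M :: "(nat \<Rightarrow> real) set pmf" and q :: real
  assumes d: "d \<ge> 1" and q: "0 \<le> q"
    and supp: "set_pmf M \<subseteq> Pow (cube01 d)"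
    and avoid: "\<And>T. T \<subseteq> cube01 d \<Longrightarrow> measure_pmf.prob M {U. U \<inter> T = {}} \<le> exp (- q * card T)"
    and incl: "\<And>T. T \<subseteq> cube01 d \<Longrightarrow> measure_pmf.prob M {U. T \<subseteq> U} \<le> q ^ card T"
  shows "1 - (2 / exp 1) ^ d - (1 / 2) ^ (11 * d) \<le>
    measure_pmf.prob M {U. polytope_edge_expansion (convex hull U) \<ge> ereal (1 / (12 * real d))}"
    (is "_ \<le> measure_pmf.prob M ?G")
proof -
  obtain k where k: "k \<le> d" "k = 0 \<or> q * 2 ^ (d - k) \<ge> real d"
    "k = d \<or> q * 2 ^ (d - k) \<le> 2 * real d"
    using exists_block_dimension by blast
  define B where "B a = {x \<in> cube01 d. ones_below k x = a}" for a
  have B: "B a \<subseteq> cube01 d" "finite (B a)" for a using finite_cube01 by (auto simp: B_def)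
  have card_B: "card (B a) = 2 ^ (d - k)" if "a \<in> Pow {..<k}" for a
    using card_cube01_block[OF k(1)] that by (simp add: B_def)
  have k2: "(2::real) ^ k \<le> 2 ^ d" using k by simp
  \<comment> \<open>The bad events: an empty block, or one with at least \<open>12 * d\<close>
    points. For \<open>k = 0\<close> there is no lower bound on the expected count, so emptiness is
    not charged to \<open>E1\<close>.\<close>
  define E1 where "E1 = (\<Union>a\<in>Pow {..<k}. if k = 0 then {} else {U. U \<inter> B a = {}})"
  define E2 where "E2 = (\<Union>a\<in>Pow {..<k}. {U. 12 * d \<le> card {x \<in> U. x \<in> B a}})"
  have "measure_pmf.prob M E1 \<le> (\<Sum>a\<in>Pow {..<k}. exp (- real d))"
  proof -
    have "measure_pmf.prob M (if k = 0 then {} else {U. U \<inter> B a = {}}) \<le> exp (- real d)"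
      if a: "a \<in> Pow {..<k}" for a
    proof (cases "k = 0")
      case False
      have "measure_pmf.prob M {U. U \<inter> B a = {}} \<le> exp (- q * card (B a))"
        using avoid B by blast
      also have "\<dots> \<le> exp (- real d)" using False k(2) card_B[OF a] by simp
      finally show ?thesis using False by simp
    qed simp
    then show ?thesis unfolding E1_def
      by (intro order_trans[OF measure_UNION_le] sum_mono) auto
  qed
  also have "\<dots> = 2 ^ k * exp (- real d)" by (simp add: card_Pow)
  also have "\<dots> \<le> 2 ^ d * exp (- real d)" using k2 by simp
  also have "\<dots> = (2 / exp 1) ^ d"
    by (simp add: power_divide exp_minus divide_inverse power_inverse exp_of_nat_mult[of d 1, simplified])
  finally have E1: "measure_pmf.prob M E1 \<le> (2 / exp 1) ^ d" .
  have "measure_pmf.prob M E2 \<le> (\<Sum>a\<in>Pow {..<k}. (1 / 2) ^ (12 * d))"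
  proof -
    have "measure_pmf.prob M {U. 12 * d \<le> card {x \<in> U. x \<in> B a}} \<le> (1 / 2) ^ (12 * d)"
      if a: "a \<in> Pow {..<k}" for a
    proof (cases "k = d")
      case True
      have "card {x \<in> U. x \<in> B a} < 12 * d" for U
      proof -
        have "card {x \<in> U. x \<in> B a} \<le> card (B a)" using B by (intro card_mono) auto
        also have "\<dots> = 1" using card_B[OF a] True by simp
        finally show ?thesis using d by linarith
      qed
      then have "{U. 12 * d \<le> card {x \<in> U. x \<in> B a}} = {}" by (auto simp: not_le)
      then show ?thesis by simp
    next
      case False
      have "measure_pmf.prob M {U. 12 * d \<le> card {x \<in> U. x \<in> B a}}
          \<le> (card (B a) * q) ^ (12 * d) / fact (12 * d)"
        using B q incl by (intro prob_subset_card_ge) (meson subset_trans)+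
      also have "\<dots> \<le> (2 * real d) ^ (12 * d) / fact (12 * d)"
        using False k(3) q card_B[OF a]
        by (intro divide_right_mono power_mono) (auto simp: mult.commute)
      \<comment> \<open>The threshold \<open>12 * d\<close> makes \<open>m / 3\<close> twice the
        bound \<open>2 * d\<close> on the expected count, which gains a factor 1/2 per point and
        outweighs the number of blocks.\<close>
      also have "\<dots> = (1 / 2) ^ (12 * d) * ((real (12 * d) / 3) ^ (12 * d) / fact (12 * d))"
      proof -
        have "2 * real d = 1 / 2 * (real (12 * d) / 3)" by simp
        then have "(2 * real d) ^ (12 * d) = (1 / 2) ^ (12 * d) * (real (12 * d) / 3) ^ (12 * d)"
          by (simp only: power_mult_distrib)
        then show ?thesis by (simp only: times_divide_eq_right)
      qed
      also have "\<dots> \<le> (1 / 2) ^ (12 * d) * 1"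
        using power_le_fact[of "12 * d"] by (intro mult_left_mono) (auto simp: divide_le_eq_1)
      finally show ?thesis by simp
    qed
    then show ?thesis unfolding E2_def
      by (intro order_trans[OF measure_UNION_le] sum_mono) auto
  qed
  also have "\<dots> = 2 ^ k * (1 / 2) ^ (12 * d)" by (simp add: card_Pow)
  also have "\<dots> \<le> 2 ^ d * (1 / 2) ^ (12 * d)" using k2 by simp
  also have "\<dots> = (1 / 2) ^ (11 * d)"
  proof -
    have "(1 / 2 :: real) ^ (12 * d) = (1 / 2) ^ d * (1 / 2) ^ (11 * d)"
      by (simp flip: power_add)
    then show ?thesis by (simp add: power_one_over)
  qed
  finally have E2: "measure_pmf.prob M E2 \<le> (1 / 2) ^ (11 * d)" .
  have "set_pmf M \<subseteq> ?G \<union> E1 \<union> E2"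
  proof
    fix U assume "U \<in> set_pmf M"
    then have U: "U \<subseteq> cube01 d" using supp by auto
    have UB: "{x \<in> U. ones_below k x = a} = {x \<in> U. x \<in> B a}" for a
      using U by (auto simp: B_def)
    show "U \<in> ?G \<union> E1 \<union> E2"
    \<comment> \<open>The empty set may escape \<open>E1\<close> when \<open>k = 0\<close>; its
      graph has no admissible vertex set, so its expansion is infinite.\<close>
    proof (cases "U = {}")
      case True
      have "polytope_vertices (convex hull {}) = ({} :: (nat \<Rightarrow> real) set)"
        using polytope_vertices_cube01[of "{}" d] by simp
      then have "U \<in> ?G"
        unfolding polytope_edge_expansion_def edge_expansion_def True mem_Collect_eq
        by (intro INF_greatest) auto
      then show ?thesis by blast
    next
      case False
      have "U \<in> ?G" if nE: "U \<notin> E1" "U \<notin> E2"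
      proof -
        have "\<exists>x\<in>U. ones_below k x = a" if "a \<subseteq> {..<k}" for a
        proof (cases "k = 0")
          case True
          then show ?thesis using that False by (auto simp: ones_below_def)
        next
          case False
          then have "U \<inter> B a \<noteq> {}" using that nE(1) unfolding E1_def by auto
          then show ?thesis by (auto simp: B_def)
        qed
        moreover have "card {x \<in> U. ones_below k x = a} \<le> 12 * d" if "a \<subseteq> {..<k}" for a
        proof -
          have "\<not> 12 * d \<le> card {x \<in> U. x \<in> B a}" using that nE(2) unfolding E2_def by blast
          then show ?thesis unfolding UB by linarith
        qed
        ultimately have "polytope_edge_expansion (convex hull U) \<ge> ereal (1 / real (12 * d))"
          using d by (intro polytope_edge_expansion_blocks[OF U]) auto
        then show ?thesis by simp
      qed
      then show ?thesis by blast
    qed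
  qed
  then have "measure_pmf.prob M (set_pmf M) \<le> measure_pmf.prob M (?G \<union> E1 \<union> E2)"
    by (intro measure_pmf.finite_measure_mono) auto
  also have "\<dots> \<le> measure_pmf.prob M (?G \<union> E1) + measure_pmf.prob M E2"
    by (intro measure_Un_le) auto
  also have "measure_pmf.prob M (?G \<union> E1) \<le> measure_pmf.prob M ?G + measure_pmf.prob M E1"
    by (intro measure_Un_le) auto
  finally show ?thesis
    using E1 E2 measure_Int_set_pmf[of M UNIV] by simp
qed

section \<open>Density bounds in the binomial and balls-into-bins models\<close>

text \<open>The density is \<open>p\<close>: \<open>T\<close> is included with probability
  \<open>p ^ card T\<close> and avoided with probability \<open>(1 - p) ^ card T\<close>.\<close>

lemma binomial_expansion_prob:
  assumes "d \<ge> 1" "0 < p" "p < 1"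
  shows "1 - (2 / exp 1) ^ d - (1 / 2) ^ (11 * d) \<le>
    measure_pmf.prob (binomial_polytope d p)
      {P. polytope_edge_expansion P \<ge> ereal (1 / (12 * real d))}"
proof -
  let ?C = "cube01 d"
  define N where "N = Pi_pmf ?C False (\<lambda>_. bernoulli_pmf p)"
  define M where "M = map_pmf (\<lambda>b. {v \<in> ?C. b v}) N"
  have prod: "measure_pmf.prob N (Pi ?C (\<lambda>v. if v \<in> T then {y} else UNIV)) =
      pmf (bernoulli_pmf p) y ^ card T" if "T \<subseteq> ?C" for T y
  proof -
    have "measure_pmf.prob N (Pi ?C (\<lambda>v. if v \<in> T then {y} else UNIV)) =
      (\<Prod>v\<in>?C. measure_pmf.prob (bernoulli_pmf p) (if v \<in> T then {y} else UNIV))"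
      unfolding N_def by (rule measure_Pi_pmf_Pi) (rule finite_cube01)
    also have "\<dots> = (\<Prod>v\<in>?C. if v \<in> T then pmf (bernoulli_pmf p) y else 1)"
      by (intro prod.cong) (auto simp: pmf.rep_eq)
    also have "\<dots> = pmf (bernoulli_pmf p) y ^ card T"
      using that finite_cube01 by (simp add: prod.If_cases Int_absorb1)
    finally show ?thesis .
  qed
  have "1 - (2 / exp 1) ^ d - (1 / 2) ^ (11 * d) \<le>
    measure_pmf.prob M {U. polytope_edge_expansion (convex hull U) \<ge> ereal (1 / (12 * real d))}"
  proof (rule expansion_prob[of d p])
    show "set_pmf M \<subseteq> Pow ?C" by (auto simp: M_def)
    fix T assume T: "T \<subseteq> ?C"
    have "(\<lambda>b. {v \<in> ?C. b v}) -` {U. U \<inter> T = {}} = Pi ?C (\<lambda>v. if v \<in> T then {False} else UNIV)"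
      using T by (auto simp: Pi_def split: if_splits)
    then have "measure_pmf.prob M {U. U \<inter> T = {}} = (1 - p) ^ card T"
      using prod[OF T, of False] assms by (simp add: M_def)
    also have "\<dots> \<le> exp (- p) ^ card T"
      using exp_ge_add_one_self[of "- p"] assms by (intro power_mono) auto
    also have "\<dots> = exp (- p * card T)"
      by (simp add: exp_of_nat_mult[symmetric] mult.commute)
    finally show "measure_pmf.prob M {U. U \<inter> T = {}} \<le> exp (- p * card T)" .
    have "(\<lambda>b. {v \<in> ?C. b v}) -` {U. T \<subseteq> U} = Pi ?C (\<lambda>v. if v \<in> T then {True} else UNIV)"
      using T by (auto simp: Pi_def split: if_splits)
    then show "measure_pmf.prob M {U. T \<subseteq> U} \<le> p ^ card T"
      using prod[OF T, of True] assms by (simp add: M_def)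
  qed (use assms in auto)
  then show ?thesis
    by (simp add: binomial_polytope_def M_def N_def vimage_def)
qed

text \<open>The density is the mean number of balls per bin. Inclusion of \<open>T\<close> is a
  union bound over assignments of a ball to each point of \<open>T\<close>.\<close>

lemma balls_into_bins_expansion_prob:
  assumes "d \<ge> 1"
  shows "1 - (2 / exp 1) ^ d - (1 / 2) ^ (11 * d) \<le>
    measure_pmf.prob (balls_into_bins_polytope d n)
      {P. polytope_edge_expansion P \<ge> ereal (1 / (12 * real d))}"
proof -
  let ?C = "cube01 d" and ?I = "{1..n}"
  define N where "N = Pi_pmf ?I 0 (\<lambda>_. pmf_of_set ?C)"
  define M where "M = map_pmf (\<lambda>s. s ` ?I) N"
  have card_pos: "real (card ?C) > 0" by (simp add: card_cube01)
  have prob_C: "measure_pmf.prob (pmf_of_set ?C) Y = card (?C \<inter> Y) / card ?C" for Y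
    by (rule measure_pmf_of_set) (auto simp: finite_cube01 cube01_nonempty)
  have prob_Pi: "measure_pmf.prob N (Pi ?I Y) = (\<Prod>j\<in>?I. card (?C \<inter> Y j) / card ?C)" for Y
    unfolding N_def by (subst measure_Pi_pmf_Pi) (simp_all add: prob_C)
  have "1 - (2 / exp 1) ^ d - (1 / 2) ^ (11 * d) \<le>
    measure_pmf.prob M {U. polytope_edge_expansion (convex hull U) \<ge> ereal (1 / (12 * real d))}"
  proof (rule expansion_prob[of d "n / card ?C"])
    show "set_pmf M \<subseteq> Pow ?C"
      using finite_cube01 cube01_nonempty
      by (auto simp: M_def N_def set_Pi_pmf PiE_dflt_def)
    fix T assume T: "T \<subseteq> ?C"
    then have finT: "finite T" using finite_cube01 finite_subset by blast
    have "(\<lambda>s. s ` ?I) -` {U. U \<inter> T = {}} = Pi ?I (\<lambda>_. - T)" by auto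
    then have "measure_pmf.prob M {U. U \<inter> T = {}} = (card (?C \<inter> - T) / card ?C) ^ n"
      using prob_Pi by (simp add: M_def)
    also have "?C \<inter> - T = ?C - T" by auto
    also have "card (?C - T) / card ?C = 1 - card T / card ?C"
      using T finT card_mono[OF finite_cube01 T] card_pos
      by (simp add: card_Diff_subset of_nat_diff field_simps)
    also have "(1 - card T / card ?C) ^ n \<le> exp (- (card T / card ?C)) ^ n"
      using exp_ge_add_one_self[of "- (card T / card ?C)"] card_mono[OF finite_cube01 T] card_pos
      by (intro power_mono) auto
    also have "\<dots> = exp (- (n / card ?C) * card T)"
      by (simp add: exp_of_nat_mult[symmetric] mult.commute)
    finally show "measure_pmf.prob M {U. U \<inter> T = {}} \<le> exp (- (n / card ?C) * card T)" .
    \<comment> \<open>A ball hits only one point, so the assignment is injective; distinct balls are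
      independent, which gives each assignment probability
      \<open>(1 / card ?C) ^ card T\<close>.\<close>
    define G where "G = {g \<in> T \<rightarrow>\<^sub>E ?I. inj_on g T}"
    have finG: "finite G" unfolding G_def using finT by (intro finite_Collect_conjI disjI1) (auto intro: finite_PiE)
    have "(\<lambda>s. s ` ?I) -` {U. T \<subseteq> U} \<subseteq> (\<Union>g\<in>G. {s. \<forall>t\<in>T. s (g t) = t})"
    proof
      fix s assume "s \<in> (\<lambda>s. s ` ?I) -` {U. T \<subseteq> U}"
      then have "\<forall>t\<in>T. \<exists>j\<in>?I. s j = t" by (force simp del: atLeastAtMost_iff)
      then obtain g where g: "\<forall>t\<in>T. g t \<in> ?I \<and> s (g t) = t" by metis
      then have "restrict g T \<in> G"
        unfolding G_def by (auto intro!: inj_onI) metis+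
      then show "s \<in> (\<Union>g\<in>G. {s. \<forall>t\<in>T. s (g t) = t})"
        using g by (intro UN_I) auto
    qed
    then have "measure_pmf.prob M {U. T \<subseteq> U} \<le> measure_pmf.prob N (\<Union>g\<in>G. {s. \<forall>t\<in>T. s (g t) = t})"
      unfolding M_def measure_map_pmf by (intro measure_pmf.finite_measure_mono) auto
    also have "\<dots> \<le> (\<Sum>g\<in>G. measure_pmf.prob N {s. \<forall>t\<in>T. s (g t) = t})"
      using finG by (intro measure_UNION_le) auto
    also have "\<dots> = (\<Sum>g\<in>G. (1 / card ?C) ^ card T)"
    proof (rule sum.cong[OF refl])
      fix g assume "g \<in> G"
      then have g: "g ` T \<subseteq> ?I" "inj_on g T" by (auto simp: G_def)
      have "{s. \<forall>t\<in>T. s (g t) = t} = Pi ?I (\<lambda>j. if j \<in> g ` T then {inv_into T g j} else UNIV)"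
      proof (intro equalityI subsetI)
        fix s assume "s \<in> {s. \<forall>t\<in>T. s (g t) = t}"
        then show "s \<in> Pi ?I (\<lambda>j. if j \<in> g ` T then {inv_into T g j} else UNIV)"
          using g by auto
      next
        fix s assume s: "s \<in> Pi ?I (\<lambda>j. if j \<in> g ` T then {inv_into T g j} else UNIV)"
        have "s (g t) = t" if "t \<in> T" for t
        proof -
          have "g t \<in> ?I" "g t \<in> g ` T" using g that by auto
          then have "s (g t) = inv_into T g (g t)" using Pi_mem[OF s, of "g t"] by simp
          then show ?thesis using g that by simp
        qed
        then show "s \<in> {s. \<forall>t\<in>T. s (g t) = t}" by simp
      qed
      then have "measure_pmf.prob N {s. \<forall>t\<in>T. s (g t) = t} =
         (\<Prod>j\<in>?I. card (?C \<inter> (if j \<in> g ` T then {inv_into T g j} else UNIV)) / card ?C)"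
        using prob_Pi by simp
      also have "\<dots> = (\<Prod>j\<in>?I. if j \<in> g ` T then 1 / card ?C else 1)"
      proof (rule prod.cong[OF refl])
        fix j
        have "?C \<inter> {inv_into T g j} = {inv_into T g j}" if "j \<in> g ` T"
          using inv_into_into[OF that] T by auto
        then show "card (?C \<inter> (if j \<in> g ` T then {inv_into T g j} else UNIV)) / card ?C =
           (if j \<in> g ` T then 1 / card ?C else 1)"
          using card_pos by auto
      qed
      also have "\<dots> = (1 / card ?C) ^ card (g ` T)"
        using g by (simp add: prod.If_cases Int_absorb1 del: image_subset_iff)
      finally show "measure_pmf.prob N {s. \<forall>t\<in>T. s (g t) = t} = (1 / card ?C) ^ card T"
        using g by (simp add: card_image)
    qed
    also have "\<dots> = card G * (1 / card ?C) ^ card T" by simp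
    also have "\<dots> \<le> real n ^ card T * (1 / card ?C) ^ card T"
    proof (rule mult_right_mono)
      have "card G \<le> card (T \<rightarrow>\<^sub>E ?I)"
        unfolding G_def using finT by (intro card_mono) (auto intro: finite_PiE)
      also have "\<dots> = n ^ card T" using finT by (simp add: card_PiE)
      finally show "real (card G) \<le> real n ^ card T"
        by (metis of_nat_le_iff of_nat_power)
    qed simp
    also have "\<dots> = (n / card ?C) ^ card T" by (simp add: power_divide)
    finally show "measure_pmf.prob M {U. T \<subseteq> U} \<le> (n / card ?C) ^ card T" .
  qed (use assms in auto)
  then show ?thesis
    by (simp add: balls_into_bins_polytope_def M_def N_def vimage_def)
qed

section \<open>Density bounds in the uniform model\<close>

text \<open>Deleting one of \<open>m\<close> points scales the number of \<open>n\<close>-subsets by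
  \<open>(m - n) / m\<close>, at most \<open>(N - n) / N\<close> as \<open>m \<le> N\<close>. The
  product form avoids division.\<close>

lemma binomial_remove_le:
  assumes "t \<le> N"
  shows "((N - t) choose n) * N ^ t \<le> (N choose n) * (N - n) ^ t"
  using assms
proof (induction t)
  case (Suc t)
  define m where "m = N - t"
  have m: "0 < m" "m \<le> N" using Suc.prems by (auto simp: m_def)
  have "m * (((m - 1) choose n) * N ^ Suc t) = ((m - n) * N) * ((m choose n) * N ^ t)"
    using arg_cong[OF binomial_absorb_comp[of m n], of "\<lambda>x. x * N ^ Suc t"]
    by (simp only: power_Suc mult_ac)
  also have "\<dots> \<le> (m * (N - n)) * ((N choose n) * (N - n) ^ t)"
  proof (rule mult_mono)
    have "n * m \<le> n * N" using m by simp
    then show "(m - n) * N \<le> m * (N - n)"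
      by (simp add: diff_mult_distrib diff_mult_distrib2 mult.commute diff_le_mono2)
    show "(m choose n) * N ^ t \<le> (N choose n) * (N - n) ^ t"
      using Suc by (simp add: m_def)
  qed auto
  also have "\<dots> = m * ((N choose n) * (N - n) ^ Suc t)" by simp
  finally have "((m - 1) choose n) * N ^ Suc t \<le> (N choose n) * (N - n) ^ Suc t"
    using m by simp
  then show ?case by (simp add: m_def)
qed simp

lemma card_subsets_avoiding_le:
  assumes "finite C" "T \<subseteq> C" "n \<le> card C" "C \<noteq> {}"
  shows "card {U. U \<subseteq> C \<and> card U = n \<and> U \<inter> T = {}} / (card C choose n)
    \<le> (1 - n / card C) ^ card T"
proof -
  have "{U. U \<subseteq> C \<and> card U = n \<and> U \<inter> T = {}} = {U. U \<subseteq> C - T \<and> card U = n}" by auto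
  then have eq: "card {U. U \<subseteq> C \<and> card U = n \<and> U \<inter> T = {}} = (card C - card T) choose n"
    using assms n_subsets[of "C - T" n] finite_subset[OF \<open>T \<subseteq> C\<close>] by (simp add: card_Diff_subset)
  have pos: "real (card C) > 0" "real (card C choose n) > 0"
    using assms by (auto simp: card_gt_0_iff zero_less_binomial)
  have "real (((card C - card T) choose n) * card C ^ card T)
      \<le> real ((card C choose n) * (card C - n) ^ card T)"
    using assms by (intro of_nat_mono binomial_remove_le card_mono)
  also have "\<dots> = real (card C choose n) * (real (card C) - real n) ^ card T"
    using assms by (simp add: of_nat_diff)
  also have "real (card C) - real n = (1 - n / card C) * card C"
    using pos by (simp add: field_simps)
  finally have "real ((card C - card T) choose n) * real (card C) ^ card T \<le>
      real (card C choose n) * (1 - n / card C) ^ card T * real (card C) ^ card T"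
    by (simp add: power_mult_distrib)
  then have "real ((card C - card T) choose n) \<le> real (card C choose n) * (1 - n / card C) ^ card T"
    using pos by (simp only: mult_le_cancel_right_pos zero_less_power)
  then show ?thesis
    using pos by (simp add: eq divide_le_eq mult.commute)
qed

lemma uniform_expansion_prob:
  assumes "d \<ge> 1" and n: "n \<le> 2 ^ d"
  shows "1 - (2 / exp 1) ^ d - (1 / 2) ^ (11 * d) \<le>
    measure_pmf.prob (uniform_polytope d n)
      {P. polytope_edge_expansion P \<ge> ereal (1 / (12 * real d))}"
proof -
  let ?C = "cube01 d"
  define W where "W = {U. U \<subseteq> ?C \<and> card U = n}"
  define M where "M = pmf_of_set W"
  have W: "finite W" "W \<noteq> {}" unfolding W_def using uniform_support[OF n] by auto
  have nC: "n \<le> card ?C" using n by (simp add: card_cube01)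
  have card_pos: "real (card ?C) > 0" by (simp add: card_cube01)
  have card_W: "card W = card ?C choose n"
    unfolding W_def by (rule n_subsets) (rule finite_cube01)
  have prob_M: "measure_pmf.prob M Y = card (W \<inter> Y) / card W" for Y
    unfolding M_def using W by (intro measure_pmf_of_set)
  have "1 - (2 / exp 1) ^ d - (1 / 2) ^ (11 * d) \<le>
    measure_pmf.prob M {U. polytope_edge_expansion (convex hull U) \<ge> ereal (1 / (12 * real d))}"
  proof (rule expansion_prob[of d "n / card ?C"])
    show "set_pmf M \<subseteq> Pow ?C" using W by (auto simp: M_def W_def)
    fix T assume T: "T \<subseteq> ?C"
    have "W \<inter> {U. U \<inter> T = {}} = {U. U \<subseteq> ?C \<and> card U = n \<and> U \<inter> T = {}}"
      by (auto simp: W_def)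
    then have "measure_pmf.prob M {U. U \<inter> T = {}} \<le> (1 - n / card ?C) ^ card T"
      using card_subsets_avoiding_le[OF finite_cube01 T nC cube01_nonempty]
      by (simp add: prob_M card_W)
    also have "\<dots> \<le> exp (- (n / card ?C)) ^ card T"
      using exp_ge_add_one_self[of "- (n / card ?C)"] nC card_pos
      by (intro power_mono) (auto simp del: card_cube01)
    also have "\<dots> = exp (- (n / card ?C) * card T)"
      by (simp add: exp_of_nat_mult[symmetric] mult.commute)
    finally show "measure_pmf.prob M {U. U \<inter> T = {}} \<le> exp (- (n / card ?C) * card T)" .
    \<comment> \<open>Complementation turns inclusion of \<open>T\<close> into avoidance of
      \<open>T\<close> by a set of size \<open>card ?C - n\<close>, so the avoidance estimate serves
      both bounds.\<close>
    have "bij_betw (\<lambda>U. ?C - U) (W \<inter> {U. T \<subseteq> U})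
       {U. U \<subseteq> ?C \<and> card U = card ?C - n \<and> U \<inter> T = {}}"
    proof (rule bij_betw_byWitness[where f' = "\<lambda>U. ?C - U"])
      show "(\<lambda>U. ?C - U) ` (W \<inter> {U. T \<subseteq> U}) \<subseteq> {U. U \<subseteq> ?C \<and> card U = card ?C - n \<and> U \<inter> T = {}}"
        using finite_cube01 by (auto simp: W_def card_Diff_subset finite_subset)
      show "(\<lambda>U. ?C - U) ` {U. U \<subseteq> ?C \<and> card U = card ?C - n \<and> U \<inter> T = {}} \<subseteq> W \<inter> {U. T \<subseteq> U}"
        using finite_cube01 T nC by (auto simp: W_def card_Diff_subset finite_subset)
    qed (auto simp: W_def)
    then have "card (W \<inter> {U. T \<subseteq> U}) = card {U. U \<subseteq> ?C \<and> card U = card ?C - n \<and> U \<inter> T = {}}"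
      by (rule bij_betw_same_card)
    moreover have "card W = card ?C choose (card ?C - n)"
      using card_W binomial_symmetric[OF nC] by simp
    ultimately have "measure_pmf.prob M {U. T \<subseteq> U} \<le> (1 - (card ?C - n) / card ?C) ^ card T"
      using card_subsets_avoiding_le[OF finite_cube01 T _ cube01_nonempty, of "card ?C - n"] nC
      by (simp add: prob_M of_nat_diff)
    also have "1 - (card ?C - n) / card ?C = n / card ?C"
      using card_pos nC by (simp add: field_simps of_nat_diff)
    finally show "measure_pmf.prob M {U. T \<subseteq> U} \<le> (n / card ?C) ^ card T" .
  qed (use assms in auto)
  then show ?thesis
    by (simp add: uniform_polytope_def M_def W_def vimage_def)
qed

theorem theorem1p3:
  shows "\<exists>f :: nat \<Rightarrow> real. f \<longlonglongrightarrow> 1 \<and>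
    (\<forall>d\<ge>1.
      (\<forall>n. measure_pmf.prob (balls_into_bins_polytope d n)
              {P. polytope_edge_expansion P \<ge> ereal (1 / (12 * real d))} \<ge> f d) \<and>
      (\<forall>p. 0 < p \<and> p < 1 \<longrightarrow>
            measure_pmf.prob (binomial_polytope d p)
              {P. polytope_edge_expansion P \<ge> ereal (1 / (12 * real d))} \<ge> f d) \<and>
      (\<forall>n. 1 \<le> n \<and> n \<le> 2 ^ d \<longrightarrow>
            measure_pmf.prob (uniform_polytope d n)
              {P. polytope_edge_expansion P \<ge> ereal (1 / (12 * real d))} \<ge> f d))"
proof (intro exI[of _ "\<lambda>d. 1 - (2 / exp 1) ^ d - (1 / 2) ^ (11 * d)"] conjI allI impI)
  \<comment> \<open>The bound comes from \<open>(1 + 1/2)^2 = 9/4\<close>.\<close>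
  have "(2::real) < exp 1" using exp_ge_one_plus_x_over_n_power_n[of 2 1] by (simp add: power2_eq_square)
  then have "(\<lambda>d. (2 / exp 1 :: real) ^ d) \<longlonglongrightarrow> 0" by (intro LIMSEQ_realpow_zero) auto
  moreover have "(\<lambda>d. ((1 / 2 :: real) ^ 11) ^ d) \<longlonglongrightarrow> 0"
    by (intro LIMSEQ_realpow_zero) (auto simp: power_one_over)
  ultimately have "(\<lambda>d. 1 - (2 / exp 1 :: real) ^ d - ((1 / 2) ^ 11) ^ d) \<longlonglongrightarrow> 1 - 0 - 0"
    by (intro tendsto_diff tendsto_const)
  then show "(\<lambda>d. 1 - (2 / exp 1 :: real) ^ d - (1 / 2) ^ (11 * d)) \<longlonglongrightarrow> 1"
    by (simp add: power_mult)
qed (use balls_into_bins_expansion_prob binomial_expansion_prob uniform_expansion_prob in auto)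

end
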